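(* Let $X,Y$ be metric spaces with $X$ complete, $F:X\times\mathbb{R}_+\rightrightarrows Y$ a set-valued mapping, $W\subset X\times Y$, and $\mu:[0,+\infty]\to[0,+\infty]$ an upper semicontinuous nondecreasing function. Suppose that, for any $(x,y)\in W$, the mapping $\tau\mapsto F_\tau^{-1}(y)$ on $\mathbb{R}_+$ is outer semicontinuous at $0$ and, for some $\gamma>\delta(y,F,x)$ and any $t\in(0,\gamma)$ with $(x,t,y)\in\operatorname{gph}F$, one of the following sets of conditions is satisfied: (i) there are sequences of positive numbers $(b_n)_{n\ge0}$ and $(c_n)_{n\ge1}$ and a function $m:(0,\infty)\to(0,\infty)$ such that $m(\tau)\downarrow0$ as $\tau\downarrow0$, $c_n\downarrow0$ as $n\to\infty$, $d(x,F_{m(c_1)}^{-1}(y))<b_0$, $$d\left(u,F_{m(c_{n+1})}^{-1}(y)\right)<b_n\ \text{ for all } u\in F_{m(c_n)}^{-1}(y)\cap B\left(x,\sum_{i=0}^{n-1}b_i\right)\ (n=1,2,\ldots),$$ and $\sum_{n=0}^{\infty}b_n\le\mu(t)$; (ii) there are functions $b,m:(0,\infty)\to(0,\infty)$ such that $m(\tau)\downarrow0\Rightarrow\tau\downarrow0$ and, for any $\tau>0$ with $\mu(\tau)\le\mu(t)$, $\mu(\tau)\ge m(\tau)+\mu(b(\tau))$ and $$d\left(u,F_{b(\tau)}^{-1}(y)\right)<m(\tau)\ \text{ for all } u\in F_\tau^{-1}(y)\cap B(x,\mu(t)-\mu(\tau));$$ (iii) there are functions $b,m:(0,\infty)\to(0,\infty)$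 such that $m(\tau)\downarrow0\Rightarrow\tau\downarrow0$ and, for any $\tau>0$ with $\mu(\tau)\le\mu(t)$, $\mu(\tau)\ge m(\tau)+\mu(b(\tau))$, $F_0^{-1}(B(y,\tau))\subset F_\tau^{-1}(y)$ and $$d\left(y,F_0(B(u,m(\tau)))\right)<b(\tau)\ \text{ for all } u\in F_\tau^{-1}(y)\cap B(x,\mu(t)-\mu(\tau)).$$ Then $F$ is regular on $W$ with functional modulus $\mu$, i.e. $d(x,F_0^{-1}(y))\le\mu(\delta(y,F,x))$ for all $(x,y)\in W$.
   Context: $\mathbb{R}_+=[0,\infty)$. $B(x,r)$ is the open ball of radius $r>0$, $B(x,0)=\{x\}$, $B(x,+\infty)=X$; $(+\infty)-(+\infty):=0$. $d(x,C)=\inf_{c\in C}d(x,c)$, with $d(x,\emptyset)=+\infty$. Set-valued mappings have possibly empty values; $\operatorname{gph}F=\{(x,t,y)\mid y\in F(x,t)\}$, $F_t:=F(\cdot,t)$, $F_t(A)=\bigcup_{z\in A}F(z,t)$ for $A\subset X$, $F_t^{-1}(y)=\{x\in X\mid y\in F(x,t)\}$, $F_t^{-1}(V)=\bigcup_{v\in V}F_t^{-1}(v)$ for $V\subset Y$, and $\delta(y,F,x):=\inf\{t>0\mid y\in F(x,t)\}$ (with $\inf\emptyset=+\infty$). A mapping $\Phi:\mathbb{R}_+\rightrightarrows X$ is outer semicontinuous at $\bar\tau$ if $\{z\in X\mid \liminf_{\tau\to\bar\tau,\,\tau\in\mathbb{R}_+}d(z,\Phi(\tau))=0\}\subset\Phi(\bar\tau)$.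 The notation $\downarrow0$ means convergence to $0$ through positive values; "$m(\tau)\downarrow0\Rightarrow\tau\downarrow0$" means: for any sequence of positive numbers $(\tau_n)$, if $m(\tau_n)\to0$ then $\tau_n\to0$. The set of conditions that is satisfied, and the objects in it, may depend on $(x,y)$ and $t$. *)

theory Defs
  imports "HOL-Analysis.Analysis"
begin

(* A mapping on X x [0,oo) has type 'a => real => 'b set; its values at negative
   second arguments are never used. Extended quantities in [0,+oo] are ennreal. *)

(* d(x,C); unlike infdist, it is +oo for empty C. *)
definition set_dist :: "'a::metric_space \<Rightarrow> 'a set \<Rightarrow> ennreal" where
  "set_dist x C = (INF c\<in>C. ennreal (dist x c))"

(* Open ball of extended radius, with B(x,0) = {x} and B(x,+oo) = X. *)
definition ext_ball :: "'a::metric_space \<Rightarrow> ennreal \<Rightarrow> 'a set" where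
  "ext_ball x r = (if r = 0 then {x} else {u. ennreal (dist x u) < r})"

(* Needed because the library has top - top = top on ennreal, whereas here
   (+oo) - (+oo) = 0. *)
definition ext_diff :: "ennreal \<Rightarrow> ennreal \<Rightarrow> ennreal" where
  "ext_diff a b = (if a = top \<and> b = top then 0 else a - b)"

definition gph :: "('a \<Rightarrow> real \<Rightarrow> 'b set) \<Rightarrow> ('a \<times> real \<times> 'b) set" where
  "gph F = {(x, t, y). 0 \<le> t \<and> y \<in> F x t}"

definition img :: "('a \<Rightarrow> real \<Rightarrow> 'b set) \<Rightarrow> real \<Rightarrow> 'a set \<Rightarrow> 'b set" where
  "img F t A = (\<Union>z\<in>A. F z t)"

definition pre :: "('a \<Rightarrow> real \<Rightarrow> 'b set) \<Rightarrow> real \<Rightarrow> 'b \<Rightarrow> 'a set" where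
  "pre F t y = {x. y \<in> F x t}"

definition preimg :: "('a \<Rightarrow> real \<Rightarrow> 'b set) \<Rightarrow> real \<Rightarrow> 'b set \<Rightarrow> 'a set" where
  "preimg F t V = (\<Union>v\<in>V. pre F t v)"

definition delta :: "'b \<Rightarrow> ('a \<Rightarrow> real \<Rightarrow> 'b set) \<Rightarrow> 'a \<Rightarrow> ennreal" where
  "delta y F x = Inf {ennreal t | t. t > 0 \<and> y \<in> F x t}"

(* The lower limit is over tau -> tau0, tau >= 0, tau \<noteq> tau0. *)
definition outer_semicontinuous_at :: "(real \<Rightarrow> 'a::metric_space set) \<Rightarrow> real \<Rightarrow> bool" where
  "outer_semicontinuous_at \<Phi> \<tau>0 \<longleftrightarrow>
     {z. Liminf (at \<tau>0 within {0..}) (\<lambda>\<tau>. set_dist z (\<Phi> \<tau>)) = 0} \<subseteq> \<Phi> \<tau>0"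

definition upper_semicontinuous :: "(ennreal \<Rightarrow> ennreal) \<Rightarrow> bool" where
  "upper_semicontinuous f \<longleftrightarrow> (\<forall>x. Limsup (at x) f \<le> f x)"

definition regular_on ::
  "('a::metric_space \<Rightarrow> real \<Rightarrow> 'b set) \<Rightarrow> ('a \<times> 'b) set \<Rightarrow> (ennreal \<Rightarrow> ennreal) \<Rightarrow> bool" where
  "regular_on F W \<mu> \<longleftrightarrow> (\<forall>(x, y)\<in>W. set_dist x (pre F 0 y) \<le> \<mu> (delta y F x))"

(* "m(tau) -> 0 implies tau -> 0", stated with sequences of positive numbers. *)
definition forces_to_zero :: "(real \<Rightarrow> real) \<Rightarrow> bool" where
  "forces_to_zero m \<longleftrightarrow>
     (\<forall>s::nat \<Rightarrow> real. (\<forall>n. s n > 0) \<longrightarrow> (\<lambda>n. m (s n)) \<longlonglongrightarrow> 0 \<longrightarrow> s \<longlonglongrightarrow> 0)"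

(* In the three conditions below, sequences and functions on (0,oo) are total
   functions constrained only where the mathematics uses them; c 0 is irrelevant. *)

definition cond_i ::
  "('a::metric_space \<Rightarrow> real \<Rightarrow> 'b set) \<Rightarrow> (ennreal \<Rightarrow> ennreal) \<Rightarrow> 'a \<Rightarrow> 'b \<Rightarrow> real \<Rightarrow> bool" where
  "cond_i F \<mu> x y t \<longleftrightarrow>
     (\<exists>(b::nat \<Rightarrow> real) (c::nat \<Rightarrow> real) (m::real \<Rightarrow> real).
        (\<forall>n. b n > 0) \<and> (\<forall>n\<ge>1. c n > 0) \<and> (\<forall>\<tau>>0. m \<tau> > 0) \<and>
        filterlim m (at_right 0) (at_right 0) \<and>
        filterlim c (at_right 0) sequentially \<and>
        set_dist x (pre F (m (c 1)) y) < ennreal (b 0) \<and>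
        (\<forall>n\<ge>1. \<forall>u\<in>pre F (m (c n)) y \<inter> ball x (\<Sum>i<n. b i).
           set_dist u (pre F (m (c (n + 1))) y) < ennreal (b n)) \<and>
        (\<Sum>n. ennreal (b n)) \<le> \<mu> (ennreal t))"

definition cond_ii ::
  "('a::metric_space \<Rightarrow> real \<Rightarrow> 'b set) \<Rightarrow> (ennreal \<Rightarrow> ennreal) \<Rightarrow> 'a \<Rightarrow> 'b \<Rightarrow> real \<Rightarrow> bool" where
  "cond_ii F \<mu> x y t \<longleftrightarrow>
     (\<exists>(b::real \<Rightarrow> real) (m::real \<Rightarrow> real).
        (\<forall>\<tau>>0. b \<tau> > 0) \<and> (\<forall>\<tau>>0. m \<tau> > 0) \<and> forces_to_zero m \<and>
        (\<forall>\<tau>>0. \<mu> (ennreal \<tau>) \<le> \<mu> (ennreal t) \<longrightarrow>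
           \<mu> (ennreal \<tau>) \<ge> ennreal (m \<tau>) + \<mu> (ennreal (b \<tau>)) \<and>
           (\<forall>u\<in>pre F \<tau> y \<inter> ext_ball x (ext_diff (\<mu> (ennreal t)) (\<mu> (ennreal \<tau>))).
              set_dist u (pre F (b \<tau>) y) < ennreal (m \<tau>))))"

definition cond_iii ::
  "('a::metric_space \<Rightarrow> real \<Rightarrow> 'b::metric_space set) \<Rightarrow> (ennreal \<Rightarrow> ennreal) \<Rightarrow> 'a \<Rightarrow> 'b \<Rightarrow> real \<Rightarrow> bool" where
  "cond_iii F \<mu> x y t \<longleftrightarrow>
     (\<exists>(b::real \<Rightarrow> real) (m::real \<Rightarrow> real).
        (\<forall>\<tau>>0. b \<tau> > 0) \<and> (\<forall>\<tau>>0. m \<tau> > 0) \<and> forces_to_zero m \<and>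
        (\<forall>\<tau>>0. \<mu> (ennreal \<tau>) \<le> \<mu> (ennreal t) \<longrightarrow>
           \<mu> (ennreal \<tau>) \<ge> ennreal (m \<tau>) + \<mu> (ennreal (b \<tau>)) \<and>
           preimg F 0 (ball y \<tau>) \<subseteq> pre F \<tau> y \<and>
           (\<forall>u\<in>pre F \<tau> y \<inter> ext_ball x (ext_diff (\<mu> (ennreal t)) (\<mu> (ennreal \<tau>))).
              set_dist y (img F 0 (ball u (m \<tau>))) < ennreal (b \<tau>))))"

end

theory Submission
  imports Defs
begin

text \<open>
  Fix \<open>(x, y) \<in> W\<close> and a \<open>t\<close> with \<open>y \<in> F x t\<close> that lies in the range where one of the three conditions
  is available. Each condition permits an iteration of Newton type: starting at \<open>x\<close>, one moves
  from \<open>u n\<close> to a nearby point \<open>u (n + 1)\<close> of \<open>pre F (s n) y\<close>, where the parameters \<open>s n > 0\<close> tend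
  to 0 and the step lengths add up to at most \<open>\<mu> t\<close>. The radii of the balls in the conditions are
  such that the iterates never leave the region where the next step is possible. If \<open>\<mu> t\<close> is
  finite, then the iterates form a Cauchy sequence, its limit lies in \<open>pre F 0 y\<close> by outer
  semicontinuity, and the distance from \<open>x\<close> to the limit is at most \<open>\<mu> t\<close>
  (\<open>set_dist_le_of_shrinking_steps\<close>).

  Under condition (i) step lengths and parameters are given in advance
  (\<open>set_dist_le_of_cond_i\<close>). Under condition (ii) the parameters are the iterates
  \<open>t, b t, b (b t), \<dots>\<close>, and the inequality \<open>m \<tau> + \<mu> (b \<tau>) \<le> \<mu> \<tau>\<close> telescopes: \<open>\<mu>\<close> is a budget from
  which every step pays its own length (\<open>set_dist_le_of_cond_ii\<close>). Condition (iii) is a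
  special case of (ii) (\<open>cond_ii_of_cond_iii\<close>).

  All this bounds \<open>d(x, pre F 0 y)\<close> by \<open>\<mu> t\<close> for times \<open>t\<close> at or arbitrarily close above \<open>\<delta>(y, F, x)\<close>;
  upper semicontinuity of \<open>\<mu>\<close> carries the bound over to \<open>\<mu> (\<delta>(y, F, x))\<close> itself
  (\<open>upper_semicontinuous_Inf_bound\<close>).
\<close>

section \<open>Extended distances and balls\<close>

lemma set_dist_le: "c \<in> C \<Longrightarrow> set_dist x C \<le> ennreal (dist x c)"
  unfolding set_dist_def by (rule INF_lower)

lemma set_dist_less_iff: "set_dist x C < r \<longleftrightarrow> (\<exists>c\<in>C. ennreal (dist x c) < r)"
  unfolding set_dist_def by (simp add: INF_less_iff)

lemma set_dist_less_ennrealE: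
  assumes "set_dist x C < ennreal r"
  obtains c where "c \<in> C" "dist x c < r"
  using assms by (auto simp: set_dist_less_iff ennreal_less_iff)

lemma ext_ball_dist_le: "u \<in> ext_ball x r \<Longrightarrow> ennreal (dist x u) \<le> r"
  by (auto simp: ext_ball_def split: if_splits)

lemma ext_ball_step:
  assumes u: "u \<in> ext_ball x r" and d: "dist u v < m" and r: "ennreal m + r \<le> r'"
  shows "v \<in> ext_ball x r'"
proof -
  have m: "m > 0" using d zero_le_dist[of u v] by linarith
  have r': "r' \<noteq> 0" using r m by (auto simp: add_eq_0_iff_both_eq_0)
  have "ennreal (dist x v) < r'"
  proof (cases r)
    case top
    with r show ?thesis by (simp add: top_unique)
  next
    case (real q)
    from ext_ball_dist_le[OF u] real have "dist x u \<le> q" by simp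
    with d have "dist x v < m + q" using dist_triangle[of x v u] by linarith
    hence "ennreal (dist x v) < ennreal (m + q)" by (simp add: ennreal_less_iff)
    also have "\<dots> \<le> r'" using r m real by simp
    finally show ?thesis .
  qed
  with r' show ?thesis by (simp add: ext_ball_def)
qed

section \<open>Limits of iterations with summable steps\<close>

text \<open>
  The limit inferior in the definition of outer semicontinuity is at most the limit along any
  sequence of positive parameters, so limits of points of \<open>\<Phi> (s n)\<close> belong to \<open>\<Phi> 0\<close>.
\<close>

lemma outer_semicontinuous_at_0_limit:
  fixes \<Phi> :: "real \<Rightarrow> 'a::metric_space set"
  assumes osc: "outer_semicontinuous_at \<Phi> 0"
    and s: "\<And>n. s n > 0" "s \<longlonglongrightarrow> 0"
    and v: "\<And>n. v n \<in> \<Phi> (s n)" "v \<longlonglongrightarrow> z"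
  shows "z \<in> \<Phi> 0"
proof -
  let ?f = "\<lambda>\<tau>. set_dist z (\<Phi> \<tau>)"
  have s0: "filterlim s (at 0 within {0..}) sequentially"
    using s by (auto simp: filterlim_at less_imp_le order_less_imp_not_eq2)
  have "Liminf (at 0 within {0..}) ?f \<le> \<epsilon>" if \<epsilon>: "\<epsilon> > 0" for \<epsilon>
  proof (rule ccontr)
    assume "\<not> ?thesis"
    hence "\<epsilon> < Liminf (at 0 within {0..}) ?f" by simp
    hence "\<forall>\<^sub>F \<tau> in at 0 within {0..}. \<epsilon> < ?f \<tau>"
      by (rule less_LiminfD)
    hence "\<forall>\<^sub>F n in sequentially. \<epsilon> < ?f (s n)"
      using s0 by (rule eventually_compose_filterlim)
    moreover have "(\<lambda>n. ennreal (dist z (v n))) \<longlonglongrightarrow> ennreal (dist z z)"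
      by (intro tendsto_intros v)
    hence "\<forall>\<^sub>F n in sequentially. ennreal (dist z (v n)) < \<epsilon>"
      using \<epsilon> by (auto dest: order_tendstoD(2))
    ultimately have "\<forall>\<^sub>F n in sequentially. False"
    proof eventually_elim
      case (elim n)
      have "?f (s n) \<le> ennreal (dist z (v n))" using v(1) by (rule set_dist_le)
      also have "\<dots> < \<epsilon>" by fact
      finally show False using elim by simp
    qed
    thus False by simp
  qed
  hence "Liminf (at 0 within {0..}) ?f \<le> 0" by (rule dense_ge)
  hence "Liminf (at 0 within {0..}) ?f = 0" by simp
  thus ?thesis using osc by (auto simp: outer_semicontinuous_at_def)
qed

lemma convergent_of_summable_steps:
  fixes u :: "nat \<Rightarrow> 'a::complete_space"
  assumes step: "\<And>n. dist (u n) (u (Suc n)) \<le> r n" and r: "summable r"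
  obtains z where "u \<longlonglongrightarrow> z" "dist (u 0) z \<le> suminf r"
proof -
  have r_nonneg: "r n \<ge> 0" for n
    using step[of n] zero_le_dist order_trans by blast
  have path: "dist (u k) (u (k + n)) \<le> sum r {k..<k + n}" for k n
  proof (induction n)
    case (Suc n)
    have "dist (u k) (u (k + Suc n)) \<le> dist (u k) (u (k + n)) + dist (u (k + n)) (u (Suc (k + n)))"
      using dist_triangle[of "u k" "u (Suc (k + n))" "u (k + n)"] by simp
    also have "\<dots> \<le> sum r {k..<k + n} + r (k + n)"
      using Suc step by (intro add_mono)
    finally show ?case by simp
  qed simp
  have "Cauchy u"
  proof (rule metric_CauchyI)
    fix e :: real assume "e > 0"
    with r obtain N where N: "\<And>k n. k \<ge> N \<Longrightarrow> norm (sum r {k..<n}) < e"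
      by (meson summable_Cauchy)
    have close: "dist (u k) (u n) < e" if "N \<le> k" "k \<le> n" for k n
    proof -
      have "dist (u k) (u n) \<le> sum r {k..<n}" using path[of k "n - k"] that by simp
      also have "\<dots> < e" using N[OF that(1), of n] by simp
      finally show ?thesis .
    qed
    show "\<exists>N. \<forall>k\<ge>N. \<forall>n\<ge>N. dist (u k) (u n) < e"
      using close by (metis dist_commute linear)
  qed
  then obtain z where z: "u \<longlonglongrightarrow> z" using Cauchy_convergent convergentD by blast
  have "dist (u 0) (u n) \<le> suminf r" for n
    using path[of 0 n] sum_le_suminf[OF r, of "{..<n}"] r_nonneg
    by (simp add: atLeast0LessThan)
  moreover have "(\<lambda>n. dist (u 0) (u n)) \<longlonglongrightarrow> dist (u 0) z"
    by (intro tendsto_intros z)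
  ultimately have "dist (u 0) z \<le> suminf r"
    using LIMSEQ_le_const2 by blast
  with z show thesis by (rule that)
qed

text \<open>
  The conclusion common to all iterations. The bound \<open>R\<close> is allowed to be infinite, in which
  case nothing has to converge.
\<close>

lemma set_dist_le_of_shrinking_steps:
  fixes \<Phi> :: "real \<Rightarrow> 'a::complete_space set"
  assumes osc: "outer_semicontinuous_at \<Phi> 0"
    and s: "\<And>n. s n > 0" "s \<longlonglongrightarrow> 0"
    and u: "\<And>n. u (Suc n) \<in> \<Phi> (s n)"
    and step: "\<And>n. dist (u n) (u (Suc n)) \<le> r n"
    and R: "(\<Sum>n. ennreal (r n)) \<le> R"
  shows "set_dist (u 0) (\<Phi> 0) \<le> R"
proof (cases "R = top")
  case False
  have r_nonneg: "r n \<ge> 0" for n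
    using step[of n] zero_le_dist order_trans by blast
  have fin: "(\<Sum>n. ennreal (r n)) \<noteq> top"
    using R False by (auto simp: top_unique)
  have sum: "summable r"
    using fin r_nonneg by (intro summable_suminf_not_top)
  obtain z where z: "u \<longlonglongrightarrow> z" "dist (u 0) z \<le> suminf r"
    using convergent_of_summable_steps[OF step sum] by blast
  have "z \<in> \<Phi> 0"
    using osc s u LIMSEQ_Suc[OF z(1)] by (rule outer_semicontinuous_at_0_limit)
  hence "set_dist (u 0) (\<Phi> 0) \<le> ennreal (dist (u 0) z)" by (rule set_dist_le)
  also have "\<dots> \<le> ennreal (suminf r)" using z(2) by (rule ennreal_leI)
  also have "\<dots> = (\<Sum>n. ennreal (r n))"
    using r_nonneg fin by (simp add: suminf_ennreal)
  finally show ?thesis using R by simp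
qed simp

section \<open>The iterations provided by the three conditions\<close>

text \<open>
  The \<open>n\<close>-th iterate is within the sum of the first \<open>n\<close> step lengths of \<open>x\<close>, which is exactly the
  ball on which condition (i) guarantees the next step.
\<close>

lemma set_dist_le_of_cond_i:
  fixes F :: "'a::complete_space \<Rightarrow> real \<Rightarrow> 'b set"
  assumes osc: "outer_semicontinuous_at (\<lambda>\<tau>. pre F \<tau> y) 0" and i: "cond_i F \<mu> x y t"
  shows "set_dist x (pre F 0 y) \<le> \<mu> (ennreal t)"
proof -
  obtain b c :: "nat \<Rightarrow> real" and m :: "real \<Rightarrow> real"
    where b: "\<And>n. b n > 0" and c: "\<And>n. n \<ge> 1 \<Longrightarrow> c n > 0"
      and m: "\<And>\<tau>. \<tau> > 0 \<Longrightarrow> m \<tau> > 0"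
      and m_lim: "filterlim m (at_right 0) (at_right 0)"
      and c_lim: "filterlim c (at_right 0) sequentially"
      and first: "set_dist x (pre F (m (c 1)) y) < ennreal (b 0)"
      and "next": "\<And>n u. n \<ge> 1 \<Longrightarrow> u \<in> pre F (m (c n)) y \<Longrightarrow> u \<in> ball x (\<Sum>i<n. b i) \<Longrightarrow>
        set_dist u (pre F (m (c (n + 1))) y) < ennreal (b n)"
      and bound: "(\<Sum>n. ennreal (b n)) \<le> \<mu> (ennreal t)"
    using i unfolding cond_i_def by blast
  \<comment> \<open>The starting point need not belong to any of the sets \<open>pre F (m (c n)) y\<close>.\<close>
  define P where "P n u \<longleftrightarrow>
    (if n = 0 then u = x else u \<in> pre F (m (c n)) y \<and> dist x u < (\<Sum>i<n. b i))" for n u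
  have "\<exists>v. P (Suc n) v \<and> dist u v \<le> b n" if Pu: "P n u" for n u
  proof -
    have "set_dist u (pre F (m (c (Suc n))) y) < ennreal (b n)"
      using Pu first "next"[of n u] by (cases "n = 0") (auto simp: P_def)
    then obtain v where v: "v \<in> pre F (m (c (Suc n))) y" "dist u v < b n"
      by (rule set_dist_less_ennrealE)
    have "dist x u \<le> (\<Sum>i<n. b i)"
      using Pu by (auto simp: P_def split: if_splits)
    hence "dist x v < (\<Sum>i<Suc n. b i)"
      using v dist_triangle[of x v u] by simp
    with v show ?thesis by (auto simp: P_def)
  qed
  moreover have "P 0 x" by (simp add: P_def)
  ultimately obtain u where u: "\<And>n. P n (u n)" "\<And>n. dist (u n) (u (Suc n)) \<le> b n"
    using dependent_nat_choice[of P "\<lambda>n u v. dist u v \<le> b n"] by blast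
  have "(\<lambda>n. m (c n)) \<longlonglongrightarrow> 0"
    using filterlim_compose[OF m_lim c_lim] by (simp add: filterlim_at)
  hence "(\<lambda>n. m (c (Suc n))) \<longlonglongrightarrow> 0" by (rule LIMSEQ_Suc)
  moreover have "m (c (Suc n)) > 0" for n by (simp add: m c)
  moreover have "u (Suc n) \<in> pre F (m (c (Suc n))) y" for n
    using u(1)[of "Suc n"] by (simp add: P_def)
  ultimately have "set_dist (u 0) (pre F 0 y) \<le> \<mu> (ennreal t)"
    using set_dist_le_of_shrinking_steps[OF osc, of "\<lambda>n. m (c (Suc n))" u b] u(2) bound by simp
  moreover have "u 0 = x" using u(1)[of 0] by (simp add: P_def)
  ultimately show ?thesis by simp
qed

text \<open>
  With \<open>T n\<close> the \<open>n\<close>-th iterate of \<open>t\<close> under \<open>b\<close>, the first \<open>n\<close> steps have used up at most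
  \<open>\<mu> t - \<mu> (T n)\<close>, which is the radius of the ball on which condition (ii) guarantees the next step.
  The step lengths \<open>m (T n)\<close> are summable and thus tend to 0, which forces \<open>T n\<close> to 0.
\<close>

lemma set_dist_le_of_cond_ii:
  fixes F :: "'a::complete_space \<Rightarrow> real \<Rightarrow> 'b set"
  assumes osc: "outer_semicontinuous_at (\<lambda>\<tau>. pre F \<tau> y) 0"
    and t: "t > 0" "x \<in> pre F t y" and ii: "cond_ii F \<mu> x y t"
  shows "set_dist x (pre F 0 y) \<le> \<mu> (ennreal t)"
proof (cases "\<mu> (ennreal t) = top")
  case False
  obtain b m :: "real \<Rightarrow> real"
    where b: "\<And>\<tau>. \<tau> > 0 \<Longrightarrow> b \<tau> > 0" and m: "\<And>\<tau>. \<tau> > 0 \<Longrightarrow> m \<tau> > 0" and forces: "forces_to_zero m"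
      and budget: "\<And>\<tau>. \<tau> > 0 \<Longrightarrow> \<mu> (ennreal \<tau>) \<le> \<mu> (ennreal t) \<Longrightarrow>
        ennreal (m \<tau>) + \<mu> (ennreal (b \<tau>)) \<le> \<mu> (ennreal \<tau>)"
      and "next": "\<And>\<tau> u. \<tau> > 0 \<Longrightarrow> \<mu> (ennreal \<tau>) \<le> \<mu> (ennreal t) \<Longrightarrow> u \<in> pre F \<tau> y \<Longrightarrow>
        u \<in> ext_ball x (ext_diff (\<mu> (ennreal t)) (\<mu> (ennreal \<tau>))) \<Longrightarrow>
        set_dist u (pre F (b \<tau>) y) < ennreal (m \<tau>)"
    using ii unfolding cond_ii_def by blast
  define T where "T n = (b ^^ n) t" for n
  define M where "M n = \<mu> (ennreal (T n))" for n
  have T_0: "T 0 = t" and T_Suc: "T (Suc n) = b (T n)" for n by (simp_all add: T_def)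
  have T_pos: "T n > 0" for n by (induction n) (simp_all add: T_0 T_Suc t b)
  have M_le: "M n \<le> M 0" for n
  proof (induction n)
    case (Suc n)
    have "M (Suc n) \<le> ennreal (m (T n)) + M (Suc n)" by simp
    also have "\<dots> \<le> M n" using budget[OF T_pos] Suc by (simp add: M_def T_0 T_Suc)
    finally show ?case using Suc by simp
  qed simp
  have M_step: "ennreal (m (T n)) + M (Suc n) \<le> M n" for n
    using budget[OF T_pos] M_le by (simp add: M_def T_0 T_Suc)
  have M0: "M 0 \<noteq> top" using False by (simp add: M_def T_0)
  have M_fin: "M n \<noteq> top" for n using M_le[of n] M0 by (auto simp: top_unique)
  have paid: "ennreal (m (T n)) + (M 0 - M n) \<le> M 0 - M (Suc n)" for n
  proof -
    have "ennreal (m (T n)) + (M 0 - M n) + M (Suc n) = (M 0 - M n) + (ennreal (m (T n)) + M (Suc n))"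
      by (simp add: ac_simps)
    also have "\<dots> \<le> (M 0 - M n) + M n" by (intro add_left_mono M_step)
    also have "\<dots> = M 0" using M_le by (simp add: diff_add_cancel_ennreal)
    finally have "ennreal (m (T n)) + (M 0 - M n) + M (Suc n) - M (Suc n) \<le> M 0 - M (Suc n)"
      by (rule ennreal_minus_mono) simp
    thus ?thesis by (simp only: ennreal_add_diff_cancel_right[OF M_fin])
  qed
  define P where "P n u \<longleftrightarrow> u \<in> pre F (T n) y \<and> u \<in> ext_ball x (M 0 - M n)" for n u
  have "\<exists>v. P (Suc n) v \<and> dist u v \<le> m (T n)" if Pu: "P n u" for n u
  proof -
    have "set_dist u (pre F (T (Suc n)) y) < ennreal (m (T n))"
      using "next"[OF T_pos] Pu M_le[of n] M0 by (simp add: P_def M_def T_0 T_Suc ext_diff_def)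
    then obtain v where v: "v \<in> pre F (T (Suc n)) y" "dist u v < m (T n)"
      by (rule set_dist_less_ennrealE)
    have "u \<in> ext_ball x (M 0 - M n)" using Pu by (simp add: P_def)
    hence "v \<in> ext_ball x (M 0 - M (Suc n))" using v(2) paid by (rule ext_ball_step)
    with v show ?thesis by (auto simp: P_def)
  qed
  moreover have "P 0 x"
    using t M0 by (simp add: P_def T_0 ext_ball_def)
  ultimately obtain u where u: "\<And>n. P n (u n)" "\<And>n. dist (u n) (u (Suc n)) \<le> m (T n)"
    using dependent_nat_choice[of P "\<lambda>n u v. dist u v \<le> m (T n)"] by blast
  have partial: "(\<Sum>i<n. ennreal (m (T i))) + M n \<le> M 0" for n
  proof (induction n)
    case (Suc n)
    have "(\<Sum>i<Suc n. ennreal (m (T i))) + M (Suc n)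
        = (\<Sum>i<n. ennreal (m (T i))) + (ennreal (m (T n)) + M (Suc n))"
      by (simp add: ac_simps)
    also have "\<dots> \<le> (\<Sum>i<n. ennreal (m (T i))) + M n"
      by (intro add_left_mono M_step)
    also have "\<dots> \<le> M 0" by (rule Suc)
    finally show ?case .
  qed simp
  have total: "(\<Sum>n. ennreal (m (T n))) \<le> M 0"
  proof (rule suminf_le_const)
    show "(\<Sum>i<n. ennreal (m (T i))) \<le> M 0" for n
      using partial[of n] by (rule order_trans[rotated]) simp
  qed simp
  have "summable (\<lambda>n. m (T n))"
    using total M0 m T_pos by (intro summable_suminf_not_top) (auto simp: top_unique less_imp_le)
  hence "(\<lambda>n. m (T n)) \<longlonglongrightarrow> 0" by (rule summable_LIMSEQ_zero)
  hence "T \<longlonglongrightarrow> 0"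
    using forces T_pos by (auto simp: forces_to_zero_def)
  hence "(\<lambda>n. T (Suc n)) \<longlonglongrightarrow> 0" by (rule LIMSEQ_Suc)
  hence "set_dist (u 0) (pre F 0 y) \<le> M 0"
    using set_dist_le_of_shrinking_steps[OF osc, of "\<lambda>n. T (Suc n)" u "\<lambda>n. m (T n)"]
      T_pos u total by (simp add: P_def)
  \<comment> \<open>The ball of radius \<open>M 0 - M 0 = 0\<close> is the singleton of \<open>x\<close> by convention, which pins the start.\<close>
  moreover have "u 0 = x" using u(1)[of 0] M0 by (simp add: P_def ext_ball_def)
  ultimately show ?thesis by (simp add: M_def T_0)
qed simp

text \<open>
  A point \<open>z\<close> near \<open>u\<close> that \<open>F\<close> at time 0 maps to within \<open>b \<tau>\<close> of \<open>y\<close> belongs to \<open>pre F (b \<tau>) y\<close>, by the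
  inclusion in (iii) at the parameter \<open>b \<tau>\<close>. That parameter is admissible because the
  budget inequality gives \<open>\<mu> (b \<tau>) \<le> \<mu> \<tau> \<le> \<mu> t\<close>.
\<close>

lemma cond_ii_of_cond_iii:
  assumes iii: "cond_iii F \<mu> x y t"
  shows "cond_ii F \<mu> x y t"
proof -
  obtain b m :: "real \<Rightarrow> real"
    where b: "\<forall>\<tau>>0. b \<tau> > 0" and m: "\<forall>\<tau>>0. m \<tau> > 0" and forces: "forces_to_zero m"
      and all: "\<forall>\<tau>>0. \<mu> (ennreal \<tau>) \<le> \<mu> (ennreal t) \<longrightarrow>
        \<mu> (ennreal \<tau>) \<ge> ennreal (m \<tau>) + \<mu> (ennreal (b \<tau>)) \<and>
        preimg F 0 (ball y \<tau>) \<subseteq> pre F \<tau> y \<and>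
        (\<forall>u\<in>pre F \<tau> y \<inter> ext_ball x (ext_diff (\<mu> (ennreal t)) (\<mu> (ennreal \<tau>))).
          set_dist y (img F 0 (ball u (m \<tau>))) < ennreal (b \<tau>))"
    using iii unfolding cond_iii_def by (elim exE conjE) (rule that; assumption)
  have budget: "ennreal (m \<tau>) + \<mu> (ennreal (b \<tau>)) \<le> \<mu> (ennreal \<tau>)"
    and incl: "preimg F 0 (ball y \<tau>) \<subseteq> pre F \<tau> y"
    and "next": "\<forall>u\<in>pre F \<tau> y \<inter> ext_ball x (ext_diff (\<mu> (ennreal t)) (\<mu> (ennreal \<tau>))).
      set_dist y (img F 0 (ball u (m \<tau>))) < ennreal (b \<tau>)"
    if "\<tau> > 0" "\<mu> (ennreal \<tau>) \<le> \<mu> (ennreal t)" for \<tau>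
    using all that by simp_all
  have step: "set_dist u (pre F (b \<tau>) y) < ennreal (m \<tau>)"
    if \<tau>: "\<tau> > 0" "\<mu> (ennreal \<tau>) \<le> \<mu> (ennreal t)"
      and u: "u \<in> pre F \<tau> y \<inter> ext_ball x (ext_diff (\<mu> (ennreal t)) (\<mu> (ennreal \<tau>)))" for \<tau> u
  proof -
    obtain v where "v \<in> img F 0 (ball u (m \<tau>))" and v: "dist y v < b \<tau>"
      using bspec[OF "next"[OF \<tau>] u] by (rule set_dist_less_ennrealE)
    then obtain z where z: "dist u z < m \<tau>" "v \<in> F z 0"
      by (auto simp: img_def)
    have "\<mu> (ennreal (b \<tau>)) \<le> ennreal (m \<tau>) + \<mu> (ennreal (b \<tau>))" by simp
    also have "\<dots> \<le> \<mu> (ennreal t)" using budget[OF \<tau>] \<tau>(2) by simp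
    finally have "preimg F 0 (ball y (b \<tau>)) \<subseteq> pre F (b \<tau>) y"
      using incl b \<tau>(1) by blast
    moreover have "z \<in> preimg F 0 (ball y (b \<tau>))"
      using z v by (auto simp: preimg_def pre_def)
    ultimately show ?thesis
      using z(1) by (auto simp: set_dist_less_iff ennreal_less_iff)
  qed
  show ?thesis
    unfolding cond_ii_def
    by (intro exI[of _ b] exI[of _ m] conjI allI impI ballI b m forces budget step)
qed

section \<open>Passing to the infimum of admissible times\<close>

text \<open>
  Either the infimum belongs to \<open>S\<close>, or it is approached from within \<open>S\<close> by values different
  from it, and then upper semicontinuity applies.
\<close>

lemma upper_semicontinuous_Inf_bound:
  assumes usc: "upper_semicontinuous \<mu>"
    and \<gamma>: "Inf S < \<gamma>"
    and bound: "\<And>s. s \<in> S \<Longrightarrow> s < \<gamma> \<Longrightarrow> D \<le> \<mu> s"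
  shows "D \<le> \<mu> (Inf S)"
proof (cases "Inf S \<in> S")
  case True
  with bound \<gamma> show ?thesis by simp
next
  case False
  have "D \<le> Limsup (at (Inf S)) \<mu>"
  proof (rule ccontr)
    assume "\<not> ?thesis"
    hence "\<forall>\<^sub>F s in at (Inf S). \<mu> s < D"
      by (intro Limsup_lessD) simp
    then obtain U where U: "open U" "Inf S \<in> U" "\<And>s. s \<in> U \<Longrightarrow> s \<noteq> Inf S \<Longrightarrow> \<mu> s < D"
      unfolding eventually_at_topological by blast
    obtain r where r: "Inf S < r" "{Inf S..<r} \<subseteq> U"
      using open_right[OF U(1,2) \<gamma>] by blast
    obtain s where s: "s \<in> S" "s < min r \<gamma>"
      using r(1) \<gamma> Inf_less_iff[of S "min r \<gamma>"] by auto
    have "Inf S \<le> s" using s(1) by (rule Inf_lower)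
    with r s have "s \<in> U" by auto
    moreover have "s \<noteq> Inf S" using s False by auto
    ultimately have "\<mu> s < D" by (rule U(3))
    with bound[OF s(1)] s(2) show False by simp
  qed
  also have "\<dots> \<le> \<mu> (Inf S)" using usc by (simp add: upper_semicontinuous_def)
  finally show ?thesis .
qed

theorem theorem3p4:
  fixes F :: "'a::complete_space \<Rightarrow> real \<Rightarrow> 'b::metric_space set"
    and W :: "('a \<times> 'b) set"
    and \<mu> :: "ennreal \<Rightarrow> ennreal"
  assumes "upper_semicontinuous \<mu>" and "mono \<mu>"
    and "\<And>x y. (x, y) \<in> W \<Longrightarrow> outer_semicontinuous_at (\<lambda>\<tau>. pre F \<tau> y) 0"
    and "\<And>x y. (x, y) \<in> W \<Longrightarrow>
           \<exists>\<gamma>>delta y F x. \<forall>t>0. ennreal t < \<gamma> \<longrightarrow> (x, t, y) \<in> gph F \<longrightarrow>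
             cond_i F \<mu> x y t \<or> cond_ii F \<mu> x y t \<or> cond_iii F \<mu> x y t"
  shows "regular_on F W \<mu>"
  unfolding regular_on_def
proof safe
  fix x y assume W: "(x, y) \<in> W"
  note osc = assms(3)[OF W]
  obtain \<gamma> where \<gamma>: "\<gamma> > delta y F x"
    and conds: "\<And>t. t > 0 \<Longrightarrow> ennreal t < \<gamma> \<Longrightarrow> (x, t, y) \<in> gph F \<Longrightarrow>
      cond_i F \<mu> x y t \<or> cond_ii F \<mu> x y t \<or> cond_iii F \<mu> x y t"
    using assms(4)[OF W] by blast
  have bound: "set_dist x (pre F 0 y) \<le> \<mu> (ennreal t)"
    if t: "t > 0" "y \<in> F x t" "ennreal t < \<gamma>" for t
  proof -
    have "(x, t, y) \<in> gph F" using t by (simp add: gph_def)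
    with conds t have "cond_i F \<mu> x y t \<or> cond_ii F \<mu> x y t"
      using cond_ii_of_cond_iii by blast
    moreover have "x \<in> pre F t y" using t by (simp add: pre_def)
    ultimately show ?thesis
      using set_dist_le_of_cond_i[OF osc] set_dist_le_of_cond_ii[OF osc t(1)] by blast
  qed
  show "set_dist x (pre F 0 y) \<le> \<mu> (delta y F x)"
    unfolding delta_def
    by (rule upper_semicontinuous_Inf_bound[OF assms(1) \<gamma>[unfolded delta_def]])
       (use bound in auto)
qed

end
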